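(* Let $n\geq 2$ and for each $1\leq i\leq n$ let $g_i:\mathbb{R}\to\mathbb{R}$ be three times differentiable. Let $y\in\mathbb{R}^n$ be such that for all $i$, $g_i'(y_i)\neq 0$ and $g_i''(y_i)>0$, and consider the function $f:\mathbb{R}^n\to(0,\infty)$ defined by $$f(x)=\prod_{i=1}^{n}\exp\left(-g_i(x_i)\right).$$ Set $g=-\log f$. There exists a linear bijection $T:\mathbb{R}^n\to\mathbb{R}^n$ such that for all $x\in\mathbb{R}^n$, $$\frac{f(y+Tx)}{f(y)}=\exp\left(-x_1-\pi\sum_{i=2}^{n}x_i^2+\delta(x)\right),$$ where, for each $x\in\mathbb{R}^n$, there is a point $w=w(x)\in\mathbb{R}^n$ satisfying $$\left(\sum_{i=1}^{n}g_i''(y_i)w_i^2\right)^{1/2}\leq |x_1|\left(\sum_{i=1}^{n}\frac{g_i'(y_i)^4}{|\nabla g(y)|^4}\frac{g_i''(y_i)}{g_i'(y_i)^2}\right)^{1/2}+\sqrt{2\pi}\left(\sum_{i=2}^{n}x_i^2\right)^{1/2}$$ such that $|\delta(x)|$ is bounded above by $$\begin{aligned} &\frac12|x_1|^2\sum_{i=1}^{n}\frac{g_i'(y_i)^4}{|\nabla g(y)|^4}\frac{g_i''(y_i)}{g_i'(y_i)^2}+\sqrt{2\pi}\,|x_1|\left(\sum_{i=2}^{n}x_i^2\right)^{1/2}\left(\sum_{i=1}^{n}\frac{g_i'(y_i)^4}{|\nabla g(y)|^4}\frac{g_i''(y_i)}{g_i'(y_i)^2}\right)^{1/2}\\ &+\frac16|x_1|^3\sum_{i=1}^{n}\frac{g_i'(y_i)^6}{|\nabla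 g(y)|^6}\frac{g_i''(y_i)^{3/2}}{|g_i'(y_i)|^3}\frac{|g_i'''(y_i+w_i)|}{g_i''(y_i)^{3/2}}\\ &+\sqrt{\frac{\pi}{2}}\,|x_1|^2\left(\sum_{i=2}^{n}x_i^2\right)^{1/2}\left(\sum_{i=1}^{n}\frac{g_i'(y_i)^8}{|\nabla g(y)|^8}\frac{g_i''(y_i)^2}{g_i'(y_i)^4}\frac{|g_i'''(y_i+w_i)|^2}{g_i''(y_i)^3}\right)^{1/2}\\ &+\pi|x_1|\left(\sum_{i=2}^{n}x_i^2\right)\max_{1\leq i\leq n}\left\{\frac{g_i'(y_i)^2}{|\nabla g(y)|^2}\frac{g_i''(y_i)^{1/2}}{|g_i'(y_i)|}\frac{|g_i'''(y_i+w_i)|}{g_i''(y_i)^{3/2}}\right\}\\ &+\frac{\sqrt{2\pi^3}}{3}\left(\sum_{i=2}^{n}x_i^2\right)^{3/2}\max_{1\leq i\leq n}\left\{\frac{|g_i'''(y_i+w_i)|}{g_i''(y_i)^{3/2}}\right\}. \end{aligned}$$ Furthermore, $T$ is of the form $$Tz=\frac{\nabla g(y)}{|\nabla g(y)|^2}z_1+Q(z_2,z_3,\ldots,z_n),$$ where $Q:\mathbb{R}^{n-1}\to\nabla f(y)^{\bot}$ is linear, and $$|\mathrm{Det}\,T|=(2\pi)^{(n-1)/2}\left(\sum_{i=1}^{n}\frac{g_i'(y_i)^2}{g_i''(y_i)}\right)^{-1/2}\left(\prod_{i=1}^{n}g_i''(y_i)\right)^{-1/2}.$$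
   Context: $|\cdot|$ is the Euclidean norm, and for a nonzero vector $v\in\mathbb{R}^n$, $v^{\bot}$ is the orthogonal complement of $v$ with respect to the standard inner product. Here $\nabla g(y)=(g_1'(y_1),\ldots,g_n'(y_n))$. *)

theory Defs
  imports "HOL-Analysis.Analysis"
begin

text \<open>\<open>m\<close>-fold differentiability on the whole line; no continuity of the \<open>m\<close>-th derivative
  is required.\<close>

definition times_differentiable :: "nat \<Rightarrow> (real \<Rightarrow> real) \<Rightarrow> bool" where
  "times_differentiable m h \<longleftrightarrow> (\<forall>k<m. \<forall>t. ((deriv ^^ k) h) differentiable (at t))"

text \<open>As with \<^const>\<open>deriv\<close>, the value is only meaningful where the function is differentiable.\<close>

definition gradient :: "('a::real_inner \<Rightarrow> real) \<Rightarrow> 'a \<Rightarrow> 'a" where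
  "gradient F x = (THE D. GDERIV F x :> D)"

lemma gradient_eq:
  assumes "GDERIV F x :> D"
  shows "gradient F x = D"
  unfolding gradient_def
proof (rule the_equality[where P = "\<lambda>D. GDERIV F x :> D"])
  fix D' assume "GDERIV F x :> D'"
  then have "(\<lambda>h. h \<bullet> D') = (\<lambda>h. h \<bullet> D)"
    using assms unfolding gderiv_def by (rule has_derivative_unique)
  then have "(D' - D) \<bullet> D' = (D' - D) \<bullet> D"
    by (rule fun_cong)
  then have "(D' - D) \<bullet> (D' - D) = 0"
    by (simp add: inner_diff_right)
  then show "D' = D"
    by simp
qed (rule assms)

end

(* Write a for the gradient of G at y and D for the diagonal matrix with entries
   sqrt (g_i''(y_i)). Choose an orthogonal R taking the first unit vector to the direction of
   D^-1 a; then Q = sqrt (2 pi) D^-1 R, restricted to the remaining coordinates, maps into the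
   orthogonal complement of a and turns the Hessian form into 2 pi |.|^2. With
   T x = x_1 a / |a|^2 + Q x', Taylor's theorem with Lagrange remainder in each coordinate gives
   the expansion of log f, and expanding (x_1 a_i / |a|^2 + (Q x')_i)^3 bounds the remainder,
   the mixed terms by Cauchy-Schwarz and by maxima. *)

theory Submission
  imports Defs
begin

section \<open>Taylor expansion in one variable and gradients of separable sums\<close>

lemma taylor_third_order:
  assumes "times_differentiable 3 h"
  obtains w where "\<bar>w\<bar> \<le> \<bar>u\<bar>"
    "h (t + u) - h t = deriv h t * u + (deriv ^^ 2) h t * u\<^sup>2 / 2 + (deriv ^^ 3) h (t + w) * u ^ 3 / 6"
proof (cases "u = 0")
  case True
  \<comment> \<open>Taylor's theorem asks for an evaluation point different from \<open>t\<close>,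
    so a zero increment is treated separately.\<close>
  then show ?thesis using that[of 0] by simp
next
  case False
  have D: "DERIV ((deriv ^^ k) h) s :> (deriv ^^ Suc k) h s" if "k < 3" for k s
    using assms that unfolding times_differentiable_def
    by (simp add: DERIV_deriv_iff_real_differentiable)
  have "\<exists>s. (if t + u < t then t + u < s \<and> s < t else t < s \<and> s < t + u) \<and>
    h (t + u) = (\<Sum>m<3. ((deriv ^^ m) h t / fact m) * (t + u - t) ^ m)
      + ((deriv ^^ 3) h s / fact 3) * (t + u - t) ^ 3"
    \<comment> \<open>An interval symmetric about \<open>t\<close> contains \<open>t + u\<close> for
      either sign of \<open>u\<close>.\<close>
    by (rule Taylor[where a = "t - \<bar>u\<bar>" and b = "t + \<bar>u\<bar>"])
      (use D False in auto)
  then obtain s where s: "if t + u < t then t + u < s \<and> s < t else t < s \<and> s < t + u"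
    and eq: "h (t + u) = (\<Sum>m<3. ((deriv ^^ m) h t / fact m) * u ^ m) + ((deriv ^^ 3) h s / fact 3) * u ^ 3"
    by auto
  have "\<bar>s - t\<bar> \<le> \<bar>u\<bar>" using s by (auto split: if_splits)
  moreover have "h (t + u) - h t =
      deriv h t * u + (deriv ^^ 2) h t * u\<^sup>2 / 2 + (deriv ^^ 3) h (t + (s - t)) * u ^ 3 / 6"
    unfolding eq by (simp add: numeral_3_eq_3 numeral_2_eq_2 fact_numeral)
  ultimately show ?thesis by (rule that)
qed

lemma GDERIV_sum_nth:
  fixes y :: "real ^ 'n"
  assumes "\<And>i. DERIV (h i) (y $ i) :> d $ i"
  shows "GDERIV (\<lambda>x. \<Sum>i\<in>UNIV. h i (x $ i)) y :> d"
proof -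
  have "((\<lambda>x. h i (x $ i)) has_derivative (\<lambda>v. v $ i * d $ i)) (at y)" for i
    using has_derivative_compose[OF bounded_linear_imp_has_derivative[OF bounded_linear_vec_nth]
        assms[unfolded has_field_derivative_def]]
    by (simp add: mult.commute)
  then show ?thesis
    unfolding gderiv_def inner_vec_def inner_real_def by (intro has_derivative_sum)
qed

section \<open>Weighted Euclidean inequalities and the cubic estimate\<close>

lemma norm_sq_vec: "(norm v)\<^sup>2 = (\<Sum>i\<in>UNIV. (v $ i)\<^sup>2)" for v :: "real ^ 'n"
  unfolding power2_norm_eq_inner inner_vec_def by (simp add: power2_eq_square)

lemma sum_mult_le_sqrt_sum_squares:
  fixes u v :: "'i \<Rightarrow> real"
  shows "\<bar>\<Sum>i\<in>I. u i * v i\<bar> \<le> sqrt (\<Sum>i\<in>I. (u i)\<^sup>2) * sqrt (\<Sum>i\<in>I. (v i)\<^sup>2)"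
proof -
  have "\<bar>\<Sum>i\<in>I. u i * v i\<bar> \<le> (\<Sum>i\<in>I. \<bar>u i\<bar> * \<bar>v i\<bar>)"
    using sum_abs[of "\<lambda>i. u i * v i" I] by (simp add: abs_mult)
  also note L2_set_mult_ineq
  finally show ?thesis by (simp add: L2_set_def)
qed

lemma sum_mult_le_Max_times_sum:
  fixes u v :: "'i::finite \<Rightarrow> real"
  assumes "\<And>i. v i \<ge> 0"
  shows "(\<Sum>i\<in>UNIV. u i * v i) \<le> (MAX i. u i) * (\<Sum>i\<in>UNIV. v i)"
  unfolding sum_distrib_left by (intro sum_mono mult_right_mono assms) simp

text \<open>Minkowski's inequality once \<open>sqrt (b i)\<close> is absorbed into both vectors; it
  serves to bound the point \<open>w\<close>.\<close>

lemma sqrt_weighted_sum_triangle: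
  fixes u v :: "'i \<Rightarrow> real"
  assumes "\<And>i. b i \<ge> 0"
  shows "sqrt (\<Sum>i\<in>I. b i * (u i + v i)\<^sup>2) \<le> sqrt (\<Sum>i\<in>I. b i * (u i)\<^sup>2) + sqrt (\<Sum>i\<in>I. b i * (v i)\<^sup>2)"
  using L2_set_triangle_ineq[of "\<lambda>i. sqrt (b i) * u i" "\<lambda>i. sqrt (b i) * v i" I] assms
  by (simp add: L2_set_def power_mult_distrib flip: distrib_left)

text \<open>Cauchy-Schwarz with \<open>sqrt (b i)\<close> absorbed into both vectors; it serves to
  bound the mixed Hessian term.\<close>

lemma weighted_sum_mult_le:
  fixes u v :: "'i \<Rightarrow> real"
  assumes "\<And>i. b i \<ge> 0"
  shows "\<bar>\<Sum>i\<in>I. b i * (u i * v i)\<bar> \<le> sqrt (\<Sum>i\<in>I. b i * (u i)\<^sup>2) * sqrt (\<Sum>i\<in>I. b i * (v i)\<^sup>2)"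
proof -
  have split: "sqrt (b i) * u i * (sqrt (b i) * v i) = b i * (u i * v i)" for i
    using mult.assoc[of "sqrt (b i)" "sqrt (b i)" "u i * v i"] assms[of i] by (simp add: mult_ac)
  show ?thesis
    using sum_mult_le_sqrt_sum_squares[of "\<lambda>i. sqrt (b i) * u i" "\<lambda>i. sqrt (b i) * v i" I] assms
    unfolding split by (simp add: power_mult_distrib)
qed

lemma powr_three_halves: "x \<ge> 0 \<Longrightarrow> x powr (3 / 2) = x * sqrt x" for x :: real
  using powr_add[of x 1 "1 / 2"] by (simp add: powr_half_sqrt)

text \<open>Every \<open>\<bar>v i\<bar>\<close> is at most the Euclidean norm, so one factor of
  each cube can be pulled out of the sum.\<close>

lemma sum_abs_cubed_le:
  fixes v :: "'i \<Rightarrow> real"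
  assumes "finite I"
  shows "(\<Sum>i\<in>I. \<bar>v i\<bar> ^ 3) \<le> (\<Sum>i\<in>I. (v i)\<^sup>2) powr (3 / 2)"
proof -
  define S where "S = (\<Sum>i\<in>I. (v i)\<^sup>2)"
  have S0: "S \<ge> 0" unfolding S_def by (simp add: sum_nonneg)
  have "\<bar>v i\<bar> ^ 3 \<le> sqrt S * (v i)\<^sup>2" if "i \<in> I" for i
  proof -
    have "(v i)\<^sup>2 \<le> S" unfolding S_def using that assms by (intro member_le_sum) auto
    then have "\<bar>v i\<bar> \<le> sqrt S" by (simp add: real_le_rsqrt)
    then have "\<bar>v i\<bar> * (v i)\<^sup>2 \<le> sqrt S * (v i)\<^sup>2" by (rule mult_right_mono) simp
    then show ?thesis by (simp add: power3_eq_cube power2_eq_square)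
  qed
  then have "(\<Sum>i\<in>I. \<bar>v i\<bar> ^ 3) \<le> sqrt S * S"
    unfolding S_def by (simp add: sum_distrib_left sum_mono)
  also have "\<dots> = S powr (3 / 2)" using S0 by (simp add: powr_three_halves)
  finally show ?thesis by (simp add: S_def)
qed

text \<open>In the application \<open>s * r i + q i\<close> is a coordinate of \<open>T x\<close>,
  \<open>c i\<close> the size of a third derivative, and only the \<open>b\<close>-weighted norm of
  \<open>q\<close> is known. The cube is expanded binomially: the pure \<open>r\<close> term is
  kept, the term linear in \<open>q\<close> goes by Cauchy-Schwarz, and the other two by
  maxima.\<close>

lemma sum_weighted_cube_le:
  fixes b c r q :: "'n::finite \<Rightarrow> real"
  assumes b: "\<And>i. b i > 0" and c: "\<And>i. c i \<ge> 0"
  shows "(\<Sum>i\<in>UNIV. c i * \<bar>s * r i + q i\<bar> ^ 3) \<le>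
      \<bar>s\<bar> ^ 3 * (\<Sum>i\<in>UNIV. c i * \<bar>r i\<bar> ^ 3)
    + 3 * \<bar>s\<bar>\<^sup>2 * sqrt (\<Sum>i\<in>UNIV. (c i)\<^sup>2 * r i ^ 4 / b i) * sqrt (\<Sum>i\<in>UNIV. b i * (q i)\<^sup>2)
    + 3 * \<bar>s\<bar> * (MAX i. c i * \<bar>r i\<bar> / b i) * (\<Sum>i\<in>UNIV. b i * (q i)\<^sup>2)
    + (MAX i. c i / b i powr (3 / 2)) * (\<Sum>i\<in>UNIV. b i * (q i)\<^sup>2) powr (3 / 2)"
proof -
  have "c i * \<bar>s * r i + q i\<bar> ^ 3 \<le> \<bar>s\<bar> ^ 3 * (c i * \<bar>r i\<bar> ^ 3)
      + 3 * \<bar>s\<bar>\<^sup>2 * (c i * (r i)\<^sup>2 * \<bar>q i\<bar>) + 3 * \<bar>s\<bar> * (c i * \<bar>r i\<bar> * (q i)\<^sup>2) + c i * \<bar>q i\<bar> ^ 3" for i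
  proof -
    have "\<bar>s * r i + q i\<bar> \<le> \<bar>s\<bar> * \<bar>r i\<bar> + \<bar>q i\<bar>"
      using abs_triangle_ineq[of "s * r i" "q i"] by (simp add: abs_mult)
    then have "\<bar>s * r i + q i\<bar> ^ 3 \<le> (\<bar>s\<bar> * \<bar>r i\<bar> + \<bar>q i\<bar>) ^ 3" by (rule power_mono) simp
    also have "\<dots> = \<bar>s\<bar> ^ 3 * \<bar>r i\<bar> ^ 3 + 3 * \<bar>s\<bar>\<^sup>2 * (\<bar>r i\<bar>\<^sup>2 * \<bar>q i\<bar>) + 3 * \<bar>s\<bar> * (\<bar>r i\<bar> * \<bar>q i\<bar>\<^sup>2) + \<bar>q i\<bar> ^ 3"
      by algebra
    finally have "c i * \<bar>s * r i + q i\<bar> ^ 3 \<le> c i * (\<bar>s\<bar> ^ 3 * \<bar>r i\<bar> ^ 3 + 3 * \<bar>s\<bar>\<^sup>2 * (\<bar>r i\<bar>\<^sup>2 * \<bar>q i\<bar>)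
        + 3 * \<bar>s\<bar> * (\<bar>r i\<bar> * \<bar>q i\<bar>\<^sup>2) + \<bar>q i\<bar> ^ 3)"
      using c by (rule mult_left_mono)
    then show ?thesis by (simp add: algebra_simps)
  qed
  then have "(\<Sum>i\<in>UNIV. c i * \<bar>s * r i + q i\<bar> ^ 3) \<le> (\<Sum>i\<in>UNIV. \<bar>s\<bar> ^ 3 * (c i * \<bar>r i\<bar> ^ 3)
      + 3 * \<bar>s\<bar>\<^sup>2 * (c i * (r i)\<^sup>2 * \<bar>q i\<bar>) + 3 * \<bar>s\<bar> * (c i * \<bar>r i\<bar> * (q i)\<^sup>2) + c i * \<bar>q i\<bar> ^ 3)"
    by (intro sum_mono)
  also have "\<dots> = \<bar>s\<bar> ^ 3 * (\<Sum>i\<in>UNIV. c i * \<bar>r i\<bar> ^ 3)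
      + 3 * \<bar>s\<bar>\<^sup>2 * (\<Sum>i\<in>UNIV. c i * (r i)\<^sup>2 * \<bar>q i\<bar>)
      + 3 * \<bar>s\<bar> * (\<Sum>i\<in>UNIV. c i * \<bar>r i\<bar> * (q i)\<^sup>2) + (\<Sum>i\<in>UNIV. c i * \<bar>q i\<bar> ^ 3)"
    by (simp only: sum.distrib sum_distrib_left)
  finally have bound: "(\<Sum>i\<in>UNIV. c i * \<bar>s * r i + q i\<bar> ^ 3) \<le> \<dots>" .
  have sb: "sqrt (b i) > 0" for i
    using b[of i] by auto
  have one: "(\<Sum>i\<in>UNIV. c i * (r i)\<^sup>2 * \<bar>q i\<bar>)
      \<le> sqrt (\<Sum>i\<in>UNIV. (c i)\<^sup>2 * r i ^ 4 / b i) * sqrt (\<Sum>i\<in>UNIV. b i * (q i)\<^sup>2)"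
  proof -
    \<comment> \<open>A factor \<open>sqrt (b i)\<close> is moved onto \<open>q\<close>, so that
      Cauchy-Schwarz produces its weighted norm.\<close>
    have "(\<Sum>i\<in>UNIV. c i * (r i)\<^sup>2 * \<bar>q i\<bar>) = (\<Sum>i\<in>UNIV. (c i * (r i)\<^sup>2 / sqrt (b i)) * (sqrt (b i) * \<bar>q i\<bar>))"
      by (intro sum.cong refl) (use sb in \<open>simp add: less_imp_neq[symmetric]\<close>)
    also have "\<dots> \<le> sqrt (\<Sum>i\<in>UNIV. (c i * (r i)\<^sup>2 / sqrt (b i))\<^sup>2) * sqrt (\<Sum>i\<in>UNIV. (sqrt (b i) * \<bar>q i\<bar>)\<^sup>2)"
      by (rule order_trans[OF abs_ge_self sum_mult_le_sqrt_sum_squares])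
    also have "\<dots> = sqrt (\<Sum>i\<in>UNIV. (c i)\<^sup>2 * r i ^ 4 / b i) * sqrt (\<Sum>i\<in>UNIV. b i * (q i)\<^sup>2)"
      using b by (simp add: power_mult_distrib power_divide less_imp_le)
    finally show ?thesis .
  qed
  have two: "(\<Sum>i\<in>UNIV. c i * \<bar>r i\<bar> * (q i)\<^sup>2) \<le> (MAX i. c i * \<bar>r i\<bar> / b i) * (\<Sum>i\<in>UNIV. b i * (q i)\<^sup>2)"
  proof -
    have "(\<Sum>i\<in>UNIV. c i * \<bar>r i\<bar> * (q i)\<^sup>2) = (\<Sum>i\<in>UNIV. (c i * \<bar>r i\<bar> / b i) * (b i * (q i)\<^sup>2))"
      by (intro sum.cong refl) (use b in \<open>simp add: less_imp_neq[symmetric]\<close>)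
    also have "\<dots> \<le> (MAX i. c i * \<bar>r i\<bar> / b i) * (\<Sum>i\<in>UNIV. b i * (q i)\<^sup>2)"
      by (rule sum_mult_le_Max_times_sum) (use b in \<open>simp add: less_imp_le\<close>)
    finally show ?thesis .
  qed
  have three: "(\<Sum>i\<in>UNIV. c i * \<bar>q i\<bar> ^ 3)
      \<le> (MAX i. c i / b i powr (3 / 2)) * (\<Sum>i\<in>UNIV. b i * (q i)\<^sup>2) powr (3 / 2)"
  proof -
    have p: "b i powr (3 / 2) = sqrt (b i) ^ 3" for i
      using b[of i] by (simp add: powr_half_sqrt[symmetric] powr_powr flip: powr_realpow)
    \<comment> \<open>The maximum dominates a nonnegative entry, so inequalities may be multiplied
      by it.\<close>
    have "(MAX i. c i / b i powr (3 / 2)) \<ge> c i / b i powr (3 / 2)" for i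
      by simp
    moreover have "c i / b i powr (3 / 2) \<ge> 0" for i using c by simp
    ultimately have M0: "(MAX i. c i / b i powr (3 / 2)) \<ge> 0" by (meson order_trans)
    have "(\<Sum>i\<in>UNIV. c i * \<bar>q i\<bar> ^ 3) = (\<Sum>i\<in>UNIV. (c i / b i powr (3 / 2)) * \<bar>sqrt (b i) * q i\<bar> ^ 3)"
      by (intro sum.cong refl)
        (use b sb in \<open>simp add: p abs_mult power_mult_distrib less_imp_neq[symmetric] less_imp_le\<close>)
    also have "\<dots> \<le> (MAX i. c i / b i powr (3 / 2)) * (\<Sum>i\<in>UNIV. \<bar>sqrt (b i) * q i\<bar> ^ 3)"
      by (rule sum_mult_le_Max_times_sum) simp
    also have "\<dots> \<le> (MAX i. c i / b i powr (3 / 2)) * (\<Sum>i\<in>UNIV. (sqrt (b i) * q i)\<^sup>2) powr (3 / 2)"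
      using M0 by (intro mult_left_mono sum_abs_cubed_le) simp_all
    finally show ?thesis using b by (simp add: power_mult_distrib less_imp_le)
  qed
  show ?thesis
    using bound mult_left_mono[OF one, of "3 * \<bar>s\<bar>\<^sup>2"] mult_left_mono[OF two, of "3 * \<bar>s\<bar>"] three
    by (simp add: mult.assoc)
qed

section \<open>The adapted linear change of variables and its determinant\<close>

lemma sqrt_prod: "sqrt (\<Prod>i\<in>I. b i) = (\<Prod>i\<in>I. sqrt (b i))"
  by (induction I rule: infinite_finite_induct) (simp_all add: real_sqrt_mult)

text \<open>\<open>Q\<close> pads a vector with a zero at \<open>one\<close>, rotates, and rescales
  each coordinate. The full map \<open>L\<close> turns the \<open>b\<close>-form into
  \<open>\<kappa>\<close> times the squared norm, and \<open>L v \<bullet> a\<close> sees only the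
  coordinate \<open>one\<close> of \<open>v\<close>, so padded vectors land orthogonal to
  \<open>a\<close>.\<close>

lemma exists_adapted_frame:
  fixes a :: "real ^ 'n::finite" and b :: "'n \<Rightarrow> real" and later :: "'m::finite \<Rightarrow> 'n"
  assumes later: "bij_betw later UNIV (UNIV - {one})"
    and a: "a \<noteq> 0" and b: "\<And>i. b i > 0" and \<kappa>: "\<kappa> > 0"
  obtains Q :: "real ^ 'm \<Rightarrow> real ^ 'n" where "linear Q"
    "\<And>v. Q v \<bullet> a = 0"
    "\<And>v. (\<Sum>i\<in>UNIV. b i * (Q v $ i)\<^sup>2) = \<kappa> * (norm v)\<^sup>2"
    "\<bar>det (matrix (\<lambda>z. (z $ one) *\<^sub>R (a /\<^sub>R (norm a)\<^sup>2) + Q (\<chi> j. z $ later j)))\<bar>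
      = sqrt \<kappa> ^ (CARD('n) - 1) / (sqrt (\<Sum>i\<in>UNIV. (a $ i)\<^sup>2 / b i) * sqrt (\<Prod>i\<in>UNIV. b i))"
proof -
  have inj: "inj later" and img: "range later = UNIV - {one}"
    using later by (auto simp: bij_betw_def)
  have later_ne: "later j \<noteq> one" for j using img by blast
  have inv_later: "inv later (later j) = j" for j by (rule inv_f_f[OF inj])
  have sb: "sqrt (b i) > 0" for i using b[of i] by auto
  define d :: "real ^ 'n" where "d = (\<chi> i. a $ i / sqrt (b i))"
  have d_sq: "(norm d)\<^sup>2 = (\<Sum>i\<in>UNIV. (a $ i)\<^sup>2 / b i)"
    using b by (simp add: norm_sq_vec d_def power_divide less_imp_le)
  have d0: "d \<noteq> 0"
    using a sb by (auto simp: d_def vec_eq_iff less_imp_neq[symmetric])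
  have "norm (axis one 1 :: real ^ 'n) = norm (d /\<^sub>R norm d)"
    using d0 by simp
  then obtain R :: "real ^ 'n \<Rightarrow> real ^ 'n"
    where R: "orthogonal_transformation R" and R_axis: "R (axis one 1) = d /\<^sub>R norm d"
    by (rule orthogonal_transformation_exists)
  have R_lin: "linear R" and R_inner: "R u \<bullet> R v = u \<bullet> v" for u v
    using R by (auto simp: orthogonal_transformation_def)
  \<comment> \<open>The value of \<open>inv later\<close> at \<open>one\<close> is arbitrary, but it
    is never read.\<close>
  define E :: "real ^ 'm \<Rightarrow> real ^ 'n"
    where "E v = (\<chi> i. if i = one then 0 else v $ inv later i)" for v
  have E_lin: "linear E" by (rule linearI) (auto simp: E_def vec_eq_iff)
  have E_norm: "(norm (E v))\<^sup>2 = (norm v)\<^sup>2" for v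
  proof -
    have "(norm (E v))\<^sup>2 = (\<Sum>i\<in>UNIV. (E v $ i)\<^sup>2)"
      by (rule norm_sq_vec)
    also have "\<dots> = (\<Sum>i\<in>UNIV - {one}. (v $ inv later i)\<^sup>2)"
      by (rule sum.mono_neutral_cong_right) (auto simp: E_def)
    also have "\<dots> = (\<Sum>j\<in>UNIV. (v $ j)\<^sup>2)"
      by (subst sum.reindex_bij_betw[OF later, symmetric]) (simp add: inv_later)
    also have "\<dots> = (norm v)\<^sup>2"
      by (rule norm_sq_vec[symmetric])
    finally show ?thesis .
  qed
  define L :: "real ^ 'n \<Rightarrow> real ^ 'n" where "L v = (\<chi> i. sqrt \<kappa> * R v $ i / sqrt (b i))" for v
  have L_lin: "linear L"
    by (rule linearI)
      (auto simp: L_def vec_eq_iff linear_add[OF R_lin] linear_cmul[OF R_lin] field_simps add_divide_distrib)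
  have L_inner: "L v \<bullet> a = sqrt \<kappa> * norm d * v $ one" for v
  proof -
    \<comment> \<open>The diagonal scaling is symmetric, so it can be moved from \<open>L v\<close>
      onto \<open>a\<close>, where it yields \<open>d\<close>, a multiple of the image of the unit
      vector at \<open>one\<close>.\<close>
    have "L v \<bullet> a = sqrt \<kappa> * (R v \<bullet> d)"
      by (simp add: L_def d_def inner_vec_def sum_distrib_left mult.assoc)
    also have "d = norm d *\<^sub>R R (axis one 1)" using d0 by (simp add: R_axis)
    also have "R v \<bullet> (norm d *\<^sub>R R (axis one 1)) = norm d * v $ one"
      by (simp add: R_inner inner_axis)
    finally show ?thesis by simp
  qed
  have L_sum: "(\<Sum>i\<in>UNIV. b i * (L v $ i)\<^sup>2) = \<kappa> * (norm v)\<^sup>2" for v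
  proof -
    have "(\<Sum>i\<in>UNIV. b i * (L v $ i)\<^sup>2) = (\<Sum>i\<in>UNIV. \<kappa> * (R v $ i)\<^sup>2)"
      using b \<kappa> by (intro sum.cong refl)
        (simp add: L_def power_mult_distrib power_divide less_imp_le less_imp_neq[symmetric])
    also have "\<dots> = \<kappa> * (R v \<bullet> R v)"
      by (simp add: inner_vec_def power2_eq_square sum_distrib_left)
    finally show ?thesis by (simp add: R_inner power2_norm_eq_inner)
  qed
  define Q where "Q = L \<circ> E"
  define T where "T = (\<lambda>z. (z $ one) *\<^sub>R (a /\<^sub>R (norm a)\<^sup>2) + Q (\<chi> j. z $ later j))"
  define A where "A = matrix L"
  have "det A = (\<Prod>i\<in>UNIV. sqrt \<kappa> / sqrt (b i)) * det (matrix R)"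
  proof -
    \<comment> \<open>Row \<open>i\<close> of \<open>A\<close> is a multiple of row \<open>i\<close>
      of the rotation, so the determinant is a product of scalars up to sign.\<close>
    have "A = (\<chi> i. (sqrt \<kappa> / sqrt (b i)) *s (matrix R $ i))"
      by (simp add: A_def matrix_def L_def vec_eq_iff)
    then show ?thesis using det_rows_mul[of "\<lambda>i. sqrt \<kappa> / sqrt (b i)" "\<lambda>i. matrix R $ i"]
      by (simp add: vec_lambda_eta)
  qed
  moreover have "\<bar>det (matrix R)\<bar> = 1"
    using R by simp
  moreover have "(\<Prod>i\<in>(UNIV::'n set). sqrt \<kappa> / sqrt (b i)) = sqrt \<kappa> ^ CARD('n) / sqrt (\<Prod>i\<in>UNIV. b i)"
    by (simp add: prod_dividef sqrt_prod)
  ultimately have det_A: "\<bar>det A\<bar> = sqrt \<kappa> ^ CARD('n) / sqrt (\<Prod>i\<in>UNIV. b i)"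
    using \<kappa> b by (simp add: abs_mult prod_nonneg less_imp_le)
  then have "det A \<noteq> 0"
    using \<kappa> b by (auto simp: less_imp_neq[symmetric])
  \<comment> \<open>The column of \<open>T\<close> at \<open>one\<close> is written as
    \<open>A *v x\<close>, which prepares the use of Cramer's rule; only \<open>x $ one\<close> will
    matter, and pairing with \<open>a\<close> determines it.\<close>
  then obtain x where x: "A *v x = a /\<^sub>R (norm a)\<^sup>2"
    using cramer by blast
  have A_v: "A *v v = L v" for v by (simp add: A_def matrix_works linear_matrix_vector_mul_eq L_lin)
  have "sqrt \<kappa> * norm d * x $ one = L x \<bullet> a" by (simp add: L_inner)
  also have "\<dots> = 1" using x a by (simp add: A_v power2_norm_eq_inner)
  finally have x_one: "x $ one = 1 / (sqrt \<kappa> * norm d)"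
    using d0 \<kappa> by (simp add: field_simps)
  have "matrix T = (\<chi> i j. if j = one then (A *v x) $ i else A $ i $ j)"
  proof -
    have "(\<chi> k. axis one (1::real) $ later k) = (0 :: real ^ 'm)"
      by (simp add: vec_eq_iff axis_def later_ne)
    then have "T (axis one 1) = A *v x"
      using linear_0[OF E_lin] linear_0[OF L_lin] by (simp add: T_def Q_def x)
    moreover have "T (axis j 1) = L (axis j 1)" if "j \<noteq> one" for j
    proof -
      have "later (inv later i) = i" if "i \<noteq> one" for i
        using that img by (simp add: f_inv_into_f)
      then have "E (\<chi> k. axis j 1 $ later k) = axis j 1"
        using that by (simp add: E_def vec_eq_iff axis_def)
      then show ?thesis using that by (simp add: T_def Q_def axis_def)
    qed
    ultimately show ?thesis
      by (auto simp: matrix_def vec_eq_iff A_def)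
  qed
  \<comment> \<open>T differs from L only in column one, so Cramer's rule gives its determinant.\<close>
  then have "det (matrix T) = x $ one * det A" by (simp add: cramer_lemma)
  then have "\<bar>det (matrix T)\<bar> = (1 / (sqrt \<kappa> * norm d)) * (sqrt \<kappa> ^ CARD('n) / sqrt (\<Prod>i\<in>UNIV. b i))"
    using \<kappa> by (simp add: abs_mult det_A x_one)
  \<comment> \<open>The factor split off cancels the one in the denominator of
    \<open>x $ one\<close>.\<close>
  also have "sqrt \<kappa> ^ CARD('n) = sqrt \<kappa> * sqrt \<kappa> ^ (CARD('n) - 1)"
    using power_minus_mult[of "CARD('n)" "sqrt \<kappa>"] by (simp add: mult.commute)
  also have "norm d = sqrt (\<Sum>i\<in>UNIV. (a $ i)\<^sup>2 / b i)"
    using d_sq by (metis norm_ge_zero real_sqrt_unique)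
  finally have det_T: "\<bar>det (matrix T)\<bar> = sqrt \<kappa> ^ (CARD('n) - 1)
      / (sqrt (\<Sum>i\<in>UNIV. (a $ i)\<^sup>2 / b i) * sqrt (\<Prod>i\<in>UNIV. b i))"
    using \<kappa> by simp
  show ?thesis
  proof (rule that)
    show "linear Q" unfolding Q_def by (rule linear_compose[OF E_lin L_lin])
    show "Q v \<bullet> a = 0" for v by (simp add: Q_def L_inner) (simp add: E_def)
    show "(\<Sum>i\<in>UNIV. b i * (Q v $ i)\<^sup>2) = \<kappa> * (norm v)\<^sup>2" for v
      by (simp add: Q_def L_sum E_norm)
  qed (use det_T in \<open>simp add: T_def\<close>)
qed

text \<open>The index type carries no order: \<open>one\<close> marks the first coordinate, and the
  bijection \<open>later\<close> labels the others by a second type, so that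
  \<open>real ^ 'm\<close> stands for the space of dimension n - 1.\<close>

theorem theorem6:
  fixes g :: "'n::finite \<Rightarrow> real \<Rightarrow> real"
    and y :: "real ^ 'n"
    and f G :: "real ^ 'n \<Rightarrow> real"
    and one :: 'n
    and later :: "'m::finite \<Rightarrow> 'n"
  assumes n_ge_2: "CARD('n) \<ge> 2"
    and later: "bij_betw later UNIV (UNIV - {one})"
    and g_diff: "\<And>i. times_differentiable 3 (g i)"
    and g'_nonzero: "\<And>i. deriv (g i) (y $ i) \<noteq> 0"
    and g''_pos: "\<And>i. (deriv ^^ 2) (g i) (y $ i) > 0"
    and f: "f = (\<lambda>x. \<Prod>i\<in>UNIV. exp (- g i (x $ i)))"
    and G: "G = (\<lambda>x. - ln (f x))"
  shows "\<exists>T :: real ^ 'n \<Rightarrow> real ^ 'n. linear T \<and> bij T \<and>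
    (\<exists>\<delta> :: real ^ 'n \<Rightarrow> real. \<forall>x.
      f (y + T x) / f y = exp (- (x $ one) - pi * (\<Sum>i\<in>UNIV - {one}. (x $ i)\<^sup>2) + \<delta> x) \<and>
      (\<exists>w :: real ^ 'n.
        sqrt (\<Sum>i\<in>UNIV. (deriv ^^ 2) (g i) (y $ i) * (w $ i)\<^sup>2)
          \<le> \<bar>x $ one\<bar> * sqrt (\<Sum>i\<in>UNIV. deriv (g i) (y $ i) ^ 4 / norm (gradient G y) ^ 4
                * ((deriv ^^ 2) (g i) (y $ i) / (deriv (g i) (y $ i))\<^sup>2))
            + sqrt (2 * pi) * sqrt (\<Sum>i\<in>UNIV - {one}. (x $ i)\<^sup>2) \<and>
        \<bar>\<delta> x\<bar>
          \<le> 1 / 2 * \<bar>x $ one\<bar>\<^sup>2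
              * (\<Sum>i\<in>UNIV. deriv (g i) (y $ i) ^ 4 / norm (gradient G y) ^ 4
                  * ((deriv ^^ 2) (g i) (y $ i) / (deriv (g i) (y $ i))\<^sup>2))
            + sqrt (2 * pi) * \<bar>x $ one\<bar> * sqrt (\<Sum>i\<in>UNIV - {one}. (x $ i)\<^sup>2)
              * sqrt (\<Sum>i\<in>UNIV. deriv (g i) (y $ i) ^ 4 / norm (gradient G y) ^ 4
                  * ((deriv ^^ 2) (g i) (y $ i) / (deriv (g i) (y $ i))\<^sup>2))
            + 1 / 6 * \<bar>x $ one\<bar> ^ 3
              * (\<Sum>i\<in>UNIV. deriv (g i) (y $ i) ^ 6 / norm (gradient G y) ^ 6
                  * ((deriv ^^ 2) (g i) (y $ i) powr (3 / 2) / \<bar>deriv (g i) (y $ i)\<bar> ^ 3)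
                  * (\<bar>(deriv ^^ 3) (g i) (y $ i + w $ i)\<bar> / (deriv ^^ 2) (g i) (y $ i) powr (3 / 2)))
            + sqrt (pi / 2) * \<bar>x $ one\<bar>\<^sup>2 * sqrt (\<Sum>i\<in>UNIV - {one}. (x $ i)\<^sup>2)
              * sqrt (\<Sum>i\<in>UNIV. deriv (g i) (y $ i) ^ 8 / norm (gradient G y) ^ 8
                  * (((deriv ^^ 2) (g i) (y $ i))\<^sup>2 / deriv (g i) (y $ i) ^ 4)
                  * (\<bar>(deriv ^^ 3) (g i) (y $ i + w $ i)\<bar>\<^sup>2 / (deriv ^^ 2) (g i) (y $ i) ^ 3))
            + pi * \<bar>x $ one\<bar> * (\<Sum>i\<in>UNIV - {one}. (x $ i)\<^sup>2)
              * (MAX i. (deriv (g i) (y $ i))\<^sup>2 / (norm (gradient G y))\<^sup>2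
                  * (sqrt ((deriv ^^ 2) (g i) (y $ i)) / \<bar>deriv (g i) (y $ i)\<bar>)
                  * (\<bar>(deriv ^^ 3) (g i) (y $ i + w $ i)\<bar> / (deriv ^^ 2) (g i) (y $ i) powr (3 / 2)))
            + sqrt (2 * pi ^ 3) / 3 * (\<Sum>i\<in>UNIV - {one}. (x $ i)\<^sup>2) powr (3 / 2)
              * (MAX i. \<bar>(deriv ^^ 3) (g i) (y $ i + w $ i)\<bar> / (deriv ^^ 2) (g i) (y $ i) powr (3 / 2)))) \<and>
    (\<exists>Q :: real ^ 'm \<Rightarrow> real ^ 'n. linear Q \<and> range Q \<subseteq> orthogonal_comp {gradient f y} \<and>
      (\<forall>z. T z = (z $ one) *\<^sub>R (gradient G y /\<^sub>R (norm (gradient G y))\<^sup>2) + Q (\<chi> j. z $ later j))) \<and>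
    \<bar>det (matrix T)\<bar> =
      (2 * pi) powr ((real CARD('n) - 1) / 2)
      * (\<Sum>i\<in>UNIV. (deriv (g i) (y $ i))\<^sup>2 / (deriv ^^ 2) (g i) (y $ i)) powr (- 1 / 2)
      * (\<Prod>i\<in>UNIV. (deriv ^^ 2) (g i) (y $ i)) powr (- 1 / 2)"
proof -

  \<comment> \<open>Gradients of \<open>G\<close> and \<open>f\<close> at \<open>y\<close>\<close>
  define a where "a = (\<chi> i. deriv (g i) (y $ i))"
  define b where "b i = (deriv ^^ 2) (g i) (y $ i)" for i
  have a_eq: "deriv (g i) (y $ i) = a $ i" and b_eq: "(deriv ^^ 2) (g i) (y $ i) = b i" for i
    by (simp_all add: a_def b_def)
  have b: "b i > 0" for i using g''_pos by (simp add: b_def)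
  have a_nz: "a $ i \<noteq> 0" for i using g'_nonzero by (simp add: a_def)
  then have a: "a \<noteq> 0" by (metis zero_index)
  define N where "N = norm a"
  have N: "N > 0" using a by (simp add: N_def)
  have f_exp: "f x = exp (- (\<Sum>i\<in>UNIV. g i (x $ i)))" for x
    by (simp add: f exp_sum sum_negf[symmetric])
  have f_pos: "f x > 0" for x by (simp add: f_exp)
  have "DERIV (g i) (y $ i) :> a $ i" for i
    using g_diff[of i, unfolded times_differentiable_def, rule_format, of 0 "y $ i"]
    by (simp add: a_def DERIV_deriv_iff_real_differentiable)
  then have grad: "GDERIV (\<lambda>x. \<Sum>i\<in>UNIV. g i (x $ i)) y :> a"
    by (rule GDERIV_sum_nth)
  then have grad_G: "gradient G y = a"
    by (intro gradient_eq) (simp add: G f_exp)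
  have "DERIV (\<lambda>s. exp (- s)) s :> - exp (- s)" for s :: real
    by (auto intro!: derivative_eq_intros)
  from GDERIV_DERIV_compose[OF grad this]
  have grad_f: "gradient f y = (- f y) *\<^sub>R a"
    by (intro gradient_eq) (simp add: f_exp[abs_def])

  \<comment> \<open>Construction and bijectivity of \<open>T\<close>\<close>
  have two_pi: "2 * pi > 0" by simp
  \<comment> \<open>The constant is \<open>2 * pi\<close> because half of the Hessian form enters
    the expansion, leaving \<open>pi\<close> times the squared norm.\<close>
  obtain Q :: "real ^ 'm \<Rightarrow> real ^ 'n" where Q: "linear Q" "\<And>v. Q v \<bullet> a = 0"
    "\<And>v. (\<Sum>i\<in>UNIV. b i * (Q v $ i)\<^sup>2) = 2 * pi * (norm v)\<^sup>2"
    and det_T: "\<bar>det (matrix (\<lambda>z. (z $ one) *\<^sub>R (a /\<^sub>R (norm a)\<^sup>2) + Q (\<chi> j. z $ later j)))\<bar>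
      = sqrt (2 * pi) ^ (CARD('n) - 1) / (sqrt (\<Sum>i\<in>UNIV. (a $ i)\<^sup>2 / b i) * sqrt (\<Prod>i\<in>UNIV. b i))"
    by (rule exists_adapted_frame[where b = b, OF later a b two_pi]) (rule that)
  define T where "T = (\<lambda>z. (z $ one) *\<^sub>R (a /\<^sub>R (norm a)\<^sup>2) + Q (\<chi> j. z $ later j))"
  define r where "r i = a $ i / N\<^sup>2" for i
  define q where "q x i = Q (\<chi> j. x $ later j) $ i" for x i
  define X where "X x = (\<Sum>i\<in>UNIV - {one}. (x $ i)\<^sup>2)" for x :: "real ^ 'n"
  have X0: "X x \<ge> 0" for x by (simp add: X_def sum_nonneg)
  have T_nth: "T x $ i = x $ one * r i + q x i" for x i
    by (simp add: T_def r_def q_def N_def divide_inverse_commute)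
  have q_sq: "(\<Sum>i\<in>UNIV. b i * (q x i)\<^sup>2) = 2 * pi * X x" for x
    unfolding q_def Q(3) norm_sq_vec X_def
    by (subst sum.reindex_bij_betw[OF later, symmetric]) simp
  \<comment> \<open>This is the whole first-order Taylor term.\<close>
  have T_inner: "T x \<bullet> a = x $ one" for x
    using a by (simp add: T_def inner_add_left Q(2) power2_norm_eq_inner)
  have T_lin: "linear T"
  proof -
    have "linear (\<lambda>z :: real ^ 'n. (\<chi> j. z $ later j) :: real ^ 'm)"
      by (rule linearI) (auto simp: vec_eq_iff)
    from linear_compose[OF this Q(1)]
    show ?thesis unfolding T_def o_def
      by (intro linear_compose_add) (auto intro!: linearI simp: scaleR_add_left distrib_right)
  qed
  have prods: "(\<Sum>i\<in>UNIV. (a $ i)\<^sup>2 / b i) > 0" "(\<Prod>i\<in>UNIV. b i) > 0"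
    using a_nz b by (auto intro!: sum_pos prod_pos)
  have det_nz: "det (matrix T) \<noteq> 0"
    using det_T prods unfolding T_def by (auto simp: less_imp_neq[symmetric])
  have T_bij: "bij T"
    using det_nz det_nz_iff_inj[OF T_lin] linear_injective_imp_surjective[OF T_lin]
    by (simp add: bij_def)

  \<comment> \<open>The error term and its bound\<close>
  define c where "c w i = \<bar>(deriv ^^ 3) (g i) (y $ i + w $ i)\<bar>" for w :: "real ^ 'n" and i
  \<comment> \<open>Chosen to make the exponential formula exact, so that all the content lies in
    the bound.\<close>
  define \<delta> where "\<delta> x = x $ one + pi * X x + ln (f (y + T x) / f y)" for x
  have ratio: "f (y + T x) / f y = exp (- (x $ one) - pi * X x + \<delta> x)" for x
    using f_pos by (simp add: \<delta>_def)
  have ex_w: "\<exists>w. sqrt (\<Sum>i\<in>UNIV. b i * (w $ i)\<^sup>2)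
        \<le> \<bar>x $ one\<bar> * sqrt (\<Sum>i\<in>UNIV. b i * (r i)\<^sup>2) + sqrt (2 * pi) * sqrt (X x) \<and>
      \<bar>\<delta> x\<bar> \<le> 1 / 2 * \<bar>x $ one\<bar>\<^sup>2 * (\<Sum>i\<in>UNIV. b i * (r i)\<^sup>2)
        + sqrt (2 * pi) * \<bar>x $ one\<bar> * sqrt (X x) * sqrt (\<Sum>i\<in>UNIV. b i * (r i)\<^sup>2)
        + 1 / 6 * \<bar>x $ one\<bar> ^ 3 * (\<Sum>i\<in>UNIV. c w i * \<bar>r i\<bar> ^ 3)
        + sqrt (pi / 2) * \<bar>x $ one\<bar>\<^sup>2 * sqrt (X x) * sqrt (\<Sum>i\<in>UNIV. (c w i)\<^sup>2 * r i ^ 4 / b i)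
        + pi * \<bar>x $ one\<bar> * X x * (MAX i. c w i * \<bar>r i\<bar> / b i)
        + sqrt (2 * pi ^ 3) / 3 * X x powr (3 / 2) * (MAX i. c w i / b i powr (3 / 2))" for x
  proof -
    define s where "s = x $ one"
    have "\<exists>w. \<bar>w\<bar> \<le> \<bar>T x $ i\<bar> \<and> g i (y $ i + T x $ i) - g i (y $ i)
        = a $ i * T x $ i + b i * (T x $ i)\<^sup>2 / 2 + (deriv ^^ 3) (g i) (y $ i + w) * (T x $ i) ^ 3 / 6" for i
      using taylor_third_order[OF g_diff[of i], of "T x $ i" "y $ i"] unfolding a_eq b_eq by blast
    \<comment> \<open>Each coordinate has its own intermediate point; together they form the vector
      \<open>w\<close>.\<close>
    then obtain w0 where w0: "\<And>i. \<bar>w0 i\<bar> \<le> \<bar>T x $ i\<bar>"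
      "\<And>i. g i (y $ i + T x $ i) - g i (y $ i)
        = a $ i * T x $ i + b i * (T x $ i)\<^sup>2 / 2 + (deriv ^^ 3) (g i) (y $ i + w0 i) * (T x $ i) ^ 3 / 6"
      by metis
    define w where "w = (\<chi> i. w0 i)"
    define R where "R = (\<Sum>i\<in>UNIV. (deriv ^^ 3) (g i) (y $ i + w $ i) * (T x $ i) ^ 3)"
    define p where "p = (\<Sum>i\<in>UNIV. b i * (r i * q x i))"
    define A where "A = (\<Sum>i\<in>UNIV. b i * (r i)\<^sup>2)"
    have sq_r: "(\<Sum>i\<in>UNIV. b i * (s * r i)\<^sup>2) = s\<^sup>2 * A"
      by (simp add: A_def sum_distrib_left power_mult_distrib mult.left_commute)
    \<comment> \<open>The two parts of \<open>T x\<close> are orthogonal for the standard inner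
      product, but not in general for the \<open>b\<close>-form, so the mixed term \<open>p\<close>
      remains.\<close>
    have "(\<Sum>i\<in>UNIV. b i * (T x $ i)\<^sup>2) =
        (\<Sum>i\<in>UNIV. s\<^sup>2 * (b i * (r i)\<^sup>2) + 2 * s * (b i * (r i * q x i)) + b i * (q x i)\<^sup>2)"
      by (intro sum.cong refl) (simp add: T_nth s_def power2_eq_square algebra_simps)
    also have "\<dots> = s\<^sup>2 * A + 2 * s * p + 2 * pi * X x"
      by (simp only: sum.distrib sum_distrib_left[symmetric] A_def p_def q_sq)
    finally have quad: "(\<Sum>i\<in>UNIV. b i * (T x $ i)\<^sup>2) = s\<^sup>2 * A + 2 * s * p + 2 * pi * X x" .
    have "ln (f (y + T x) / f y) = - (\<Sum>i\<in>UNIV. g i (y $ i + T x $ i) - g i (y $ i))"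
      by (simp add: f_exp ln_div sum_subtractf)
    also have "\<dots> = - (T x \<bullet> a + (\<Sum>i\<in>UNIV. b i * (T x $ i)\<^sup>2) / 2 + R / 6)"
      by (simp add: w0(2) sum.distrib R_def w_def inner_vec_def sum_divide_distrib mult.commute)
    \<comment> \<open>The linear term and \<open>pi * X x\<close> cancel against the definition of
      \<open>\<delta>\<close>.\<close>
    finally have \<delta>_eq: "\<delta> x = - (s\<^sup>2 * A / 2 + s * p + R / 6)"
      unfolding \<delta>_def T_inner quad by (simp add: s_def field_simps)
    \<comment> \<open>Coordinatewise \<open>w\<close> is no larger than \<open>T x\<close>, so its
      weighted norm is bounded by that of \<open>T x\<close>.\<close>
    have "sqrt (\<Sum>i\<in>UNIV. b i * (w $ i)\<^sup>2) \<le> sqrt (\<Sum>i\<in>UNIV. b i * (s * r i + q x i)\<^sup>2)"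
      using w0(1) b
      by (intro real_sqrt_le_mono sum_mono mult_left_mono)
        (auto simp: w_def abs_le_square_iff[symmetric] T_nth s_def less_imp_le)
    also have "\<dots> \<le> sqrt (\<Sum>i\<in>UNIV. b i * (s * r i)\<^sup>2) + sqrt (\<Sum>i\<in>UNIV. b i * (q x i)\<^sup>2)"
      using b by (intro sqrt_weighted_sum_triangle) (simp add: less_imp_le)
    finally have w_le: "sqrt (\<Sum>i\<in>UNIV. b i * (w $ i)\<^sup>2) \<le> \<bar>s\<bar> * sqrt A + sqrt (2 * pi) * sqrt (X x)"
      unfolding sq_r q_sq by (simp add: real_sqrt_mult)
    have A0: "A \<ge> 0" using b by (simp add: A_def sum_nonneg less_imp_le)
    have "\<bar>p\<bar> \<le> sqrt A * sqrt (2 * pi * X x)"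
      unfolding p_def A_def q_sq[symmetric] using b by (intro weighted_sum_mult_le) (simp add: less_imp_le)
    then have p_le: "\<bar>s * p\<bar> \<le> sqrt (2 * pi) * \<bar>s\<bar> * sqrt (X x) * sqrt A"
      using mult_left_mono[of "\<bar>p\<bar>" "sqrt A * sqrt (2 * pi * X x)" "\<bar>s\<bar>"]
      by (simp add: abs_mult real_sqrt_mult mult_ac)
    have "\<bar>R\<bar> \<le> (\<Sum>i\<in>UNIV. c w i * \<bar>s * r i + q x i\<bar> ^ 3)"
      unfolding R_def
      by (rule order_trans[OF sum_abs]) (simp add: abs_mult power_abs c_def T_nth s_def)
    also have "\<dots> \<le> \<bar>s\<bar> ^ 3 * (\<Sum>i\<in>UNIV. c w i * \<bar>r i\<bar> ^ 3)
        + 3 * \<bar>s\<bar>\<^sup>2 * sqrt (\<Sum>i\<in>UNIV. (c w i)\<^sup>2 * r i ^ 4 / b i) * sqrt (2 * pi * X x)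
        + 3 * \<bar>s\<bar> * (MAX i. c w i * \<bar>r i\<bar> / b i) * (2 * pi * X x)
        + (MAX i. c w i / b i powr (3 / 2)) * (2 * pi * X x) powr (3 / 2)"
      unfolding q_sq[symmetric] using b by (intro sum_weighted_cube_le) (simp_all add: c_def)
    finally have R_le: "\<bar>R\<bar> \<le> \<dots>" .
    \<comment> \<open>These identities match the constants after division of the cubic bound by 6:
      \<open>3 * sqrt (2 * pi) / 6\<close> is \<open>sqrt (pi / 2)\<close>, and
      \<open>2 * pi * sqrt (2 * pi) / 6\<close> is \<open>sqrt (2 * pi ^ 3) / 3\<close>.\<close>
    have half: "sqrt (pi / 2) = sqrt (2 * pi) / 2"
      by (rule real_sqrt_unique) (simp_all add: power_divide)
    have cube: "sqrt (2 * pi ^ 3) = pi * sqrt (2 * pi)"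
      by (rule real_sqrt_unique) (simp_all add: power_mult_distrib power3_eq_cube power2_eq_square)
    have root: "sqrt (2 * pi * X x) = sqrt (2 * pi) * sqrt (X x)" by (rule real_sqrt_mult)
    have powr: "(2 * pi * X x) powr (3 / 2) = 2 * pi * sqrt (2 * pi) * X x powr (3 / 2)"
      using X0[of x] by (simp add: powr_three_halves real_sqrt_mult mult_ac)
    have "\<bar>\<delta> x\<bar> \<le> s\<^sup>2 * A / 2 + \<bar>s * p\<bar> + \<bar>R\<bar> / 6"
      using mult_nonneg_nonneg[OF zero_le_power2[of s] A0] unfolding \<delta>_eq by linarith
    also have "\<dots> \<le> 1 / 2 * \<bar>s\<bar>\<^sup>2 * A
        + sqrt (2 * pi) * \<bar>s\<bar> * sqrt (X x) * sqrt A
        + 1 / 6 * \<bar>s\<bar> ^ 3 * (\<Sum>i\<in>UNIV. c w i * \<bar>r i\<bar> ^ 3)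
        + sqrt (pi / 2) * \<bar>s\<bar>\<^sup>2 * sqrt (X x) * sqrt (\<Sum>i\<in>UNIV. (c w i)\<^sup>2 * r i ^ 4 / b i)
        + pi * \<bar>s\<bar> * X x * (MAX i. c w i * \<bar>r i\<bar> / b i)
        + sqrt (2 * pi ^ 3) / 3 * X x powr (3 / 2) * (MAX i. c w i / b i powr (3 / 2))"
      using R_le p_le unfolding half cube powr root by (simp add: algebra_simps)
    finally show ?thesis using w_le unfolding s_def A_def by blast
  qed

  \<comment> \<open>Translation of the coefficients into those of the statement\<close>
  have terms:
    "a $ i ^ 4 / N ^ 4 * (b i / (a $ i)\<^sup>2) = b i * (r i)\<^sup>2"
    "a $ i ^ 6 / N ^ 6 * (b i powr (3 / 2) / \<bar>a $ i\<bar> ^ 3) * (t / b i powr (3 / 2)) = t * \<bar>r i\<bar> ^ 3"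
    "a $ i ^ 8 / N ^ 8 * ((b i)\<^sup>2 / a $ i ^ 4) * (t\<^sup>2 / b i ^ 3) = t\<^sup>2 * r i ^ 4 / b i"
    "(a $ i)\<^sup>2 / N\<^sup>2 * (sqrt (b i) / \<bar>a $ i\<bar>) * (t / b i powr (3 / 2)) = t * \<bar>r i\<bar> / b i" for i t
  proof -
    have nz: "a $ i \<noteq> 0" "N \<noteq> 0" "b i \<noteq> 0" "\<bar>a $ i\<bar> \<noteq> 0" "sqrt (b i) \<noteq> 0" "b i powr (3 / 2) \<noteq> 0"
      using a_nz[of i] N b[of i] by auto
    show "a $ i ^ 4 / N ^ 4 * (b i / (a $ i)\<^sup>2) = b i * (r i)\<^sup>2"
      using nz by (simp add: r_def field_simps power_numeral_reduce)
    \<comment> \<open>The even power is rewritten with absolute values so that it cancels against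
      the cube in the denominator.\<close>
    have "a $ i ^ 6 = \<bar>a $ i\<bar> ^ 6" by (simp add: power_even_abs)
    then show "a $ i ^ 6 / N ^ 6 * (b i powr (3 / 2) / \<bar>a $ i\<bar> ^ 3) * (t / b i powr (3 / 2)) = t * \<bar>r i\<bar> ^ 3"
      using nz by (simp add: r_def field_simps power_numeral_reduce)
    show "a $ i ^ 8 / N ^ 8 * ((b i)\<^sup>2 / a $ i ^ 4) * (t\<^sup>2 / b i ^ 3) = t\<^sup>2 * r i ^ 4 / b i"
      using nz by (simp add: r_def field_simps power_numeral_reduce)
    have "(a $ i)\<^sup>2 = \<bar>a $ i\<bar>\<^sup>2" by simp
    moreover have "b i powr (3 / 2) = b i * sqrt (b i)"
      using b[of i] by (simp add: powr_three_halves)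
    ultimately show "(a $ i)\<^sup>2 / N\<^sup>2 * (sqrt (b i) / \<bar>a $ i\<bar>) * (t / b i powr (3 / 2)) = t * \<bar>r i\<bar> / b i"
      using nz by (simp add: r_def abs_divide field_simps power2_eq_square del: abs_mult_self_eq)
  qed

  \<comment> \<open>The determinant in \<open>powr\<close> form and final assembly\<close>
  have det_eq: "\<bar>det (matrix T)\<bar> = (2 * pi) powr ((real CARD('n) - 1) / 2)
      * (\<Sum>i\<in>UNIV. (a $ i)\<^sup>2 / b i) powr (- 1 / 2) * (\<Prod>i\<in>UNIV. b i) powr (- 1 / 2)"
  proof -
    have "(2 * pi) powr ((real CARD('n) - 1) / 2) = ((2 * pi) powr (1 / 2)) powr (real (CARD('n) - 1))"
      using n_ge_2 by (simp add: powr_powr of_nat_diff)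
    also have "\<dots> = sqrt (2 * pi) ^ (CARD('n) - 1)"
      by (subst powr_realpow) (simp_all add: powr_half_sqrt)
    finally have "(2 * pi) powr ((real CARD('n) - 1) / 2) = sqrt (2 * pi) ^ (CARD('n) - 1)" .
    moreover have "t powr (- 1 / 2) = 1 / sqrt t" if "t > 0" for t :: real
      using that powr_minus_divide[of t "1 / 2"] by (simp add: powr_half_sqrt)
    ultimately show ?thesis
      using det_T prods unfolding T_def[symmetric] by simp
  qed
  \<comment> \<open>The gradient of \<open>f\<close> is a scalar multiple of \<open>a\<close>, so
    orthogonality to \<open>a\<close> carries over.\<close>
  have Q_range: "range Q \<subseteq> orthogonal_comp {gradient f y}"
    by (auto simp: grad_f orthogonal_comp_def orthogonal_def inner_commute[of a] Q(2))
  have T_eq: "T z = (z $ one) *\<^sub>R (a /\<^sub>R N\<^sup>2) + Q (\<chi> j. z $ later j)" for z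
    by (simp add: T_def N_def)
  show ?thesis
    unfolding a_eq b_eq grad_G N_def[symmetric] X_def[symmetric] c_def[symmetric] terms
    by (intro exI[of _ T] conjI exI[of _ \<delta>] exI[of _ Q] allI)
      (rule T_lin T_bij ratio ex_w Q(1) Q_range T_eq det_eq)+
qed

end
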